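(* Let $(D,\dashv,\vdash,\alpha_D,\beta_D)$ be a BiHom-associative dialgebra, $(M,\alpha_M,\beta_M)$ a BiHom-module, and let $\theta_1,\theta_2:D\times D\to M$ be bilinear maps. Put $\Theta=(\theta_1,\theta_2)$, $D_\Theta=D\oplus M$, and for $x,y\in D$, $u,v\in M$ define $$(x+u)\triangleleft(y+v)=x\dashv y+\theta_1(x,y),\qquad (x+u)\triangleright(y+v)=x\vdash y+\theta_2(x,y).$$ Then $(D_\Theta,\triangleleft,\triangleright,\alpha_D\oplus\alpha_M,\beta_D\oplus\beta_M)$ is a BiHom-associative dialgebra if and only if $\Theta$ is a $2$-cocycle on $D$ with values in $M$.
   Context: All vector spaces are over a fixed field. A BiHom-associative dialgebra is a tuple $(A,\dashv,\vdash,\alpha,\beta)$ consisting of a vector space $A$, bilinear maps $\dashv,\vdash:A\times A\to A$ and linear maps $\alpha,\beta:A\to A$ such that $\alpha\circ\beta=\beta\circ\alpha$ and, for all $x,y,z\in A$: (i) $(x\dashv y)\dashv\beta(z)=\alpha(x)\dashv(y\dashv z)$; (ii) $(x\dashv y)\dashv\beta(z)=\alpha(x)\dashv(y\vdash z)$; (iii) $(x\vdash y)\dashv\beta(z)=\alpha(x)\vdash(y\dashv z)$; (iv) $(x\dashv y)\vdash\beta(z)=\alpha(x)\vdash(y\vdash z)$; (v) $(x\vdash y)\vdash\beta(z)=\alpha(x)\vdash(y\vdash z)$. A BiHom-module $(M,\alpha_M,\beta_M)$ is a vector space $M$ with two commuting linear maps $\alpha_M,\beta_M:M\to M$. A pair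 $\Theta=(\theta_1,\theta_2)$ of bilinear maps $D\times D\to M$ is a $2$-cocycle on $D$ with values in $M$ if for all $x,y,z\in D$ (with $\alpha=\alpha_D$, $\beta=\beta_D$): $\theta_1(x\dashv y,\beta(z))=\theta_1(\alpha(x),y\dashv z)$; $\theta_1(x\dashv y,\beta(z))=\theta_1(\alpha(x),y\vdash z)$; $\theta_2(x\vdash y,\beta(z))=\theta_2(\alpha(x),y\vdash z)$; $\theta_2(x\dashv y,\beta(z))=\theta_2(\alpha(x),y\vdash z)$; $\theta_1(x\vdash y,\beta(z))=\theta_2(\alpha(x),y\dashv z)$. $(\alpha_D\oplus\alpha_M)(x+u)=\alpha_D(x)+\alpha_M(u)$, and similarly for $\beta$. *)

theory Defs
  imports "HOL-Analysis.Product_Vector"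
begin

text \<open>A vector space over a field is a whole type of class \<open>ab_group_add\<close> together with a
  scalar multiplication satisfying \<^locale>\<open>vector_space\<close>. Bilinearity is separate linearity in
  each argument; \<^const>\<open>Vector_Spaces.linear\<close> entails that domain and codomain are vector
  spaces.\<close>

definition bilinear_map ::
  "('k::field \<Rightarrow> 'a::ab_group_add \<Rightarrow> 'a) \<Rightarrow> ('k \<Rightarrow> 'b::ab_group_add \<Rightarrow> 'b) \<Rightarrow>
   ('k \<Rightarrow> 'c::ab_group_add \<Rightarrow> 'c) \<Rightarrow> ('a \<Rightarrow> 'b \<Rightarrow> 'c) \<Rightarrow> bool"
  where "bilinear_map sA sB sC f \<longleftrightarrow>
    (\<forall>y. Vector_Spaces.linear sA sC (\<lambda>x. f x y)) \<and>
    (\<forall>x. Vector_Spaces.linear sB sC (\<lambda>y. f x y))"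

locale bihom_module = vector_space scale
  for scale :: "'k::field \<Rightarrow> 'm::ab_group_add \<Rightarrow> 'm" +
  fixes \<alpha> \<beta> :: "'m \<Rightarrow> 'm"
  assumes linear_alpha: "Vector_Spaces.linear scale scale \<alpha>"
    and linear_beta: "Vector_Spaces.linear scale scale \<beta>"
    and alpha_beta_commute: "\<alpha> \<circ> \<beta> = \<beta> \<circ> \<alpha>"

text \<open>Neither multiplicativity nor bijectivity of \<open>\<alpha>\<close> and \<open>\<beta>\<close> is part of the definition.\<close>

locale bihom_dialgebra = vector_space scale
  for scale :: "'k::field \<Rightarrow> 'a::ab_group_add \<Rightarrow> 'a" +
  fixes lprod :: "'a \<Rightarrow> 'a \<Rightarrow> 'a" (infixl "\<stileturn>" 70)
    and rprod :: "'a \<Rightarrow> 'a \<Rightarrow> 'a" (infixl "\<turnstile>" 70)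
    and \<alpha> \<beta> :: "'a \<Rightarrow> 'a"
  assumes bilinear_lprod: "bilinear_map scale scale scale (\<stileturn>)"
    and bilinear_rprod: "bilinear_map scale scale scale (\<turnstile>)"
    and linear_alpha: "Vector_Spaces.linear scale scale \<alpha>"
    and linear_beta: "Vector_Spaces.linear scale scale \<beta>"
    and alpha_beta_commute: "\<alpha> \<circ> \<beta> = \<beta> \<circ> \<alpha>"
    and left_left: "(x \<stileturn> y) \<stileturn> \<beta> z = \<alpha> x \<stileturn> (y \<stileturn> z)"
    and left_bar: "(x \<stileturn> y) \<stileturn> \<beta> z = \<alpha> x \<stileturn> (y \<turnstile> z)"
    and inner: "(x \<turnstile> y) \<stileturn> \<beta> z = \<alpha> x \<turnstile> (y \<stileturn> z)"
    and right_bar: "(x \<stileturn> y) \<turnstile> \<beta> z = \<alpha> x \<turnstile> (y \<turnstile> z)"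
    and right_right: "(x \<turnstile> y) \<turnstile> \<beta> z = \<alpha> x \<turnstile> (y \<turnstile> z)"

definition two_cocycle ::
  "('k::field \<Rightarrow> 'd::ab_group_add \<Rightarrow> 'd) \<Rightarrow> ('k \<Rightarrow> 'm::ab_group_add \<Rightarrow> 'm) \<Rightarrow>
   ('d \<Rightarrow> 'd \<Rightarrow> 'd) \<Rightarrow> ('d \<Rightarrow> 'd \<Rightarrow> 'd) \<Rightarrow> ('d \<Rightarrow> 'd) \<Rightarrow> ('d \<Rightarrow> 'd) \<Rightarrow>
   ('d \<Rightarrow> 'd \<Rightarrow> 'm) \<times> ('d \<Rightarrow> 'd \<Rightarrow> 'm) \<Rightarrow> bool"
  where "two_cocycle sD sM lprod rprod \<alpha> \<beta> \<Theta> \<longleftrightarrow>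
    (case \<Theta> of (\<theta>\<^sub>1, \<theta>\<^sub>2) \<Rightarrow>
      bilinear_map sD sD sM \<theta>\<^sub>1 \<and> bilinear_map sD sD sM \<theta>\<^sub>2 \<and>
      (\<forall>x y z.
        \<theta>\<^sub>1 (lprod x y) (\<beta> z) = \<theta>\<^sub>1 (\<alpha> x) (lprod y z) \<and>
        \<theta>\<^sub>1 (lprod x y) (\<beta> z) = \<theta>\<^sub>1 (\<alpha> x) (rprod y z) \<and>
        \<theta>\<^sub>2 (rprod x y) (\<beta> z) = \<theta>\<^sub>2 (\<alpha> x) (rprod y z) \<and>
        \<theta>\<^sub>2 (lprod x y) (\<beta> z) = \<theta>\<^sub>2 (\<alpha> x) (rprod y z) \<and>
        \<theta>\<^sub>1 (rprod x y) (\<beta> z) = \<theta>\<^sub>2 (\<alpha> x) (lprod y z)))"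

text \<open>The direct sum \<open>D \<oplus> M\<close> is the product type with scalar multiplication
  \<^const>\<open>module_prod.scale\<close>; an element \<open>x + u\<close> is the pair \<open>(x, u)\<close>, and \<open>f \<oplus> g\<close> is
  \<^term>\<open>map_prod f g\<close>. For a product \<open>p\<close> on \<open>D\<close> the extended product is
  \<open>(x + u) (y + v) = p x y + \<theta> x y\<close>.\<close>

definition ext_prod ::
  "('d \<Rightarrow> 'd \<Rightarrow> 'd) \<Rightarrow> ('d \<Rightarrow> 'd \<Rightarrow> 'm) \<Rightarrow> 'd \<times> 'm \<Rightarrow> 'd \<times> 'm \<Rightarrow> 'd \<times> 'm"
  where "ext_prod p \<theta> = (\<lambda>(x, u) (y, v). (p x y, \<theta> x y))"

end

theory Submission
  imports Defs
begin

text \<open>The products of \<open>D \<oplus> M\<close> do not depend on the \<open>M\<close>-components of their arguments. Both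
  sides of each dialgebra identity on \<open>D \<oplus> M\<close> are therefore pairs whose first component is the
  corresponding side of the same identity in \<open>D\<close>, and whose second component is a value of
  \<open>\<theta>\<^sub>1\<close> or \<open>\<theta>\<^sub>2\<close> at arguments in \<open>D\<close>. Since \<open>D\<close> satisfies the identity, it holds on
  \<open>D \<oplus> M\<close> exactly when the second components agree, which is one of the five cocycle equations.
  For the direct implication the identities are evaluated at elements of the form \<open>(x, 0)\<close>. In the
  converse, the structural axioms (linearity, bilinearity, commutation of the twisting maps) hold
  componentwise for every bilinear \<open>\<theta>\<^sub>1\<close> and \<open>\<theta>\<^sub>2\<close>, by \<open>linear_map_prod\<close> and
  \<open>bilinear_map_ext_prod\<close>.\<close>

lemma ext_prod_simp [simp]: "ext_prod p \<theta> (x, u) (y, v) = (p x y, \<theta> x y)"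
  by (simp add: ext_prod_def)

lemma linear_map_prod:
  assumes "Vector_Spaces.linear sA sC f" and "Vector_Spaces.linear sB sE g"
  shows "Vector_Spaces.linear (module_prod.scale sA sB) (module_prod.scale sC sE) (map_prod f g)"
proof -
  interpret f: Vector_Spaces.linear sA sC f by fact
  interpret g: Vector_Spaces.linear sB sE g by fact
  interpret AB: vector_space_prod sA sB ..
  interpret CE: vector_space_prod sC sE ..
  show ?thesis
    by unfold_locales
      (auto simp: AB.scale_def CE.scale_def f.add g.add f.scale g.scale)
qed

text \<open>A linear map out of \<open>A\<close> with values in \<open>C \<oplus> E\<close>, given by its components, stays linear
  when it is extended to \<open>A \<oplus> B\<close> by ignoring \<open>B\<close>.\<close>

lemma linear_pair_fst:
  assumes "vector_space sB"
    and "Vector_Spaces.linear sA sC f" and "Vector_Spaces.linear sA sE g"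
  shows "Vector_Spaces.linear (module_prod.scale sA sB) (module_prod.scale sC sE)
           (\<lambda>w. (f (fst w), g (fst w)))"
proof -
  interpret B: vector_space sB by fact
  interpret f: Vector_Spaces.linear sA sC f by fact
  interpret g: Vector_Spaces.linear sA sE g by fact
  interpret AB: vector_space_prod sA sB ..
  interpret CE: vector_space_prod sC sE ..
  show ?thesis
    by unfold_locales
      (auto simp: AB.scale_def CE.scale_def f.add g.add f.scale g.scale)
qed

lemma bilinear_map_ext_prod:
  assumes "vector_space sM" and "bilinear_map sD sD sD p" and "bilinear_map sD sD sM \<theta>"
  shows "bilinear_map (module_prod.scale sD sM) (module_prod.scale sD sM)
           (module_prod.scale sD sM) (ext_prod p \<theta>)"
proof -
  have "ext_prod p \<theta> = (\<lambda>v w. (p (fst v) (fst w), \<theta> (fst v) (fst w)))"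
    by (simp add: ext_prod_def case_prod_unfold)
  moreover have "Vector_Spaces.linear (module_prod.scale sD sM) (module_prod.scale sD sM)
      (\<lambda>v. (p (fst v) y, \<theta> (fst v) y))" for y
    using assms by (intro linear_pair_fst) (simp_all add: bilinear_map_def)
  moreover have "Vector_Spaces.linear (module_prod.scale sD sM) (module_prod.scale sD sM)
      (\<lambda>w. (p x (fst w), \<theta> x (fst w)))" for x
    using assms by (intro linear_pair_fst) (simp_all add: bilinear_map_def)
  ultimately show ?thesis
    by (simp add: bilinear_map_def)
qed

theorem theorem3p7:
  fixes sD :: "'k::field \<Rightarrow> 'd::ab_group_add \<Rightarrow> 'd"
    and sM :: "'k \<Rightarrow> 'm::ab_group_add \<Rightarrow> 'm"
    and lprod rprod :: "'d \<Rightarrow> 'd \<Rightarrow> 'd"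
    and \<alpha>D \<beta>D :: "'d \<Rightarrow> 'd"
    and \<alpha>M \<beta>M :: "'m \<Rightarrow> 'm"
    and \<theta>\<^sub>1 \<theta>\<^sub>2 :: "'d \<Rightarrow> 'd \<Rightarrow> 'm"
  assumes "bihom_dialgebra sD lprod rprod \<alpha>D \<beta>D"
    and "bihom_module sM \<alpha>M \<beta>M"
    and "bilinear_map sD sD sM \<theta>\<^sub>1"
    and "bilinear_map sD sD sM \<theta>\<^sub>2"
  shows "bihom_dialgebra (module_prod.scale sD sM)
           (ext_prod lprod \<theta>\<^sub>1) (ext_prod rprod \<theta>\<^sub>2)
           (map_prod \<alpha>D \<alpha>M) (map_prod \<beta>D \<beta>M)
         \<longleftrightarrow> two_cocycle sD sM lprod rprod \<alpha>D \<beta>D (\<theta>\<^sub>1, \<theta>\<^sub>2)"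
proof -
  interpret D: bihom_dialgebra sD lprod rprod \<alpha>D \<beta>D by fact
  interpret M: bihom_module sM \<alpha>M \<beta>M by fact
  interpret DM: vector_space_prod sD sM ..
  show ?thesis
  proof
    assume "bihom_dialgebra (module_prod.scale sD sM) (ext_prod lprod \<theta>\<^sub>1) (ext_prod rprod \<theta>\<^sub>2)
              (map_prod \<alpha>D \<alpha>M) (map_prod \<beta>D \<beta>M)"
    then interpret E: bihom_dialgebra "module_prod.scale sD sM" "ext_prod lprod \<theta>\<^sub>1"
      "ext_prod rprod \<theta>\<^sub>2" "map_prod \<alpha>D \<alpha>M" "map_prod \<beta>D \<beta>M" .
    have "\<theta>\<^sub>1 (lprod x y) (\<beta>D z) = \<theta>\<^sub>1 (\<alpha>D x) (lprod y z) \<and>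
        \<theta>\<^sub>1 (lprod x y) (\<beta>D z) = \<theta>\<^sub>1 (\<alpha>D x) (rprod y z) \<and>
        \<theta>\<^sub>2 (rprod x y) (\<beta>D z) = \<theta>\<^sub>2 (\<alpha>D x) (rprod y z) \<and>
        \<theta>\<^sub>2 (lprod x y) (\<beta>D z) = \<theta>\<^sub>2 (\<alpha>D x) (rprod y z) \<and>
        \<theta>\<^sub>1 (rprod x y) (\<beta>D z) = \<theta>\<^sub>2 (\<alpha>D x) (lprod y z)" for x y z
      using E.left_left[of "(x, 0)" "(y, 0)" "(z, 0)"] E.left_bar[of "(x, 0)" "(y, 0)" "(z, 0)"]
        E.right_right[of "(x, 0)" "(y, 0)" "(z, 0)"] E.right_bar[of "(x, 0)" "(y, 0)" "(z, 0)"]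
        E.inner[of "(x, 0)" "(y, 0)" "(z, 0)"]
      by simp
    with assms(3,4) show "two_cocycle sD sM lprod rprod \<alpha>D \<beta>D (\<theta>\<^sub>1, \<theta>\<^sub>2)"
      unfolding two_cocycle_def by blast
  next
    assume "two_cocycle sD sM lprod rprod \<alpha>D \<beta>D (\<theta>\<^sub>1, \<theta>\<^sub>2)"
    then have cocycle:
      "\<theta>\<^sub>1 (lprod x y) (\<beta>D z) = \<theta>\<^sub>1 (\<alpha>D x) (lprod y z)"
      "\<theta>\<^sub>1 (lprod x y) (\<beta>D z) = \<theta>\<^sub>1 (\<alpha>D x) (rprod y z)"
      "\<theta>\<^sub>2 (rprod x y) (\<beta>D z) = \<theta>\<^sub>2 (\<alpha>D x) (rprod y z)"
      "\<theta>\<^sub>2 (lprod x y) (\<beta>D z) = \<theta>\<^sub>2 (\<alpha>D x) (rprod y z)"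
      "\<theta>\<^sub>1 (rprod x y) (\<beta>D z) = \<theta>\<^sub>2 (\<alpha>D x) (lprod y z)" for x y z
      unfolding two_cocycle_def by blast+
    show "bihom_dialgebra (module_prod.scale sD sM) (ext_prod lprod \<theta>\<^sub>1) (ext_prod rprod \<theta>\<^sub>2)
            (map_prod \<alpha>D \<alpha>M) (map_prod \<beta>D \<beta>M)"
    proof (intro bihom_dialgebra.intro bihom_dialgebra_axioms.intro)
      show "vector_space (module_prod.scale sD sM)" ..
      show "bilinear_map (module_prod.scale sD sM) (module_prod.scale sD sM)
              (module_prod.scale sD sM) (ext_prod lprod \<theta>\<^sub>1)"
        using M.vector_space_axioms D.bilinear_lprod assms(3) by (rule bilinear_map_ext_prod)
      show "bilinear_map (module_prod.scale sD sM) (module_prod.scale sD sM)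
              (module_prod.scale sD sM) (ext_prod rprod \<theta>\<^sub>2)"
        using M.vector_space_axioms D.bilinear_rprod assms(4) by (rule bilinear_map_ext_prod)
      show "Vector_Spaces.linear (module_prod.scale sD sM) (module_prod.scale sD sM)
              (map_prod \<alpha>D \<alpha>M)"
        using D.linear_alpha M.linear_alpha by (rule linear_map_prod)
      show "Vector_Spaces.linear (module_prod.scale sD sM) (module_prod.scale sD sM)
              (map_prod \<beta>D \<beta>M)"
        using D.linear_beta M.linear_beta by (rule linear_map_prod)
      show "map_prod \<alpha>D \<alpha>M \<circ> map_prod \<beta>D \<beta>M = map_prod \<beta>D \<beta>M \<circ> map_prod \<alpha>D \<alpha>M"
        by (simp add: map_prod_compose[symmetric] D.alpha_beta_commute M.alpha_beta_commute)
    next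
      fix v w t :: "'d \<times> 'm"
      obtain x y z a b c where [simp]: "v = (x, a)" "w = (y, b)" "t = (z, c)"
        by (cases v, cases w, cases t) blast
      let ?l = "ext_prod lprod \<theta>\<^sub>1" and ?r = "ext_prod rprod \<theta>\<^sub>2"
      let ?\<alpha> = "map_prod \<alpha>D \<alpha>M" and ?\<beta> = "map_prod \<beta>D \<beta>M"
      show "?l (?l v w) (?\<beta> t) = ?l (?\<alpha> v) (?l w t)"
        using D.left_left cocycle(1) by simp
      show "?l (?l v w) (?\<beta> t) = ?l (?\<alpha> v) (?r w t)"
        using D.left_bar cocycle(2) by simp
      show "?l (?r v w) (?\<beta> t) = ?r (?\<alpha> v) (?l w t)"
        using D.inner cocycle(5) by simp
      show "?r (?l v w) (?\<beta> t) = ?r (?\<alpha> v) (?r w t)"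
        using D.right_bar cocycle(4) by simp
      show "?r (?r v w) (?\<beta> t) = ?r (?\<alpha> v) (?r w t)"
        using D.right_right cocycle(3) by simp
    qed
  qed
qed

end
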